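(* Let $G=(V,E,L)$ be a graph and $q:L\to\mathbb{R}^d\setminus\{0\}$. Then $(G,q)$ can be realised as an infinitesimally rigid linearly-body-constrained body-bar framework in $\mathbb{R}^d$ if and only if $$\delta_G(\mathcal{P})\ \ge\ \binom{d+1}{2}|\mathcal{P}|-\sum_{X\in\mathcal{P},\ L(X)\neq\emptyset}\ \sum_{i=1}^{d_X+1}(d-i+1)$$ for all partitions $\mathcal{P}$ of $V$, where $d_X$ is the dimension of the affine span of $\{q(e): e\in L(X)\}$.
   Context: A graph $G=(V,E,L)$ is finite and may contain multiple edges and loops; $V$, $E$, $L$ are its sets of vertices, (non-loop) edges and loops, respectively. For a partition $\mathcal{P}$ of $V$, $\delta_G(\mathcal{P})$ is the number of edges in $E$ joining different sets in $\mathcal{P}$. For $X\subseteq V$, $L(X)$ is the set of all loops in $L$ incident to vertices of $X$. A realisation of $G$ as a linearly-body-constrained body-bar framework in $\mathbb{R}^d$ represents each vertex $v$ by a $d$-dimensional rigid body $B_v$ in $\mathbb{R}^d$, each edge $uv$ as a distance constraint (a rigid bar) between two points in $B_u$ and $B_v$, respectively, and each loop $e=vv$ as a constraint which restricts the motion of the whole body $B_v$ to be orthogonal to a given vector $q(e)\in\mathbb{R}^d$. The given data are $G$ and $q$; the bodies and the end-points of the bars are part of the realisation. Infinitesimal rigidity has its usual meaning: an infinitesimal motion assigns to each body $B_v$ an infinitesimal rigid motion $x\mapsto A_vx+b_v$ of $\mathbb{R}^d$ ($A_v$ a skew-symmetric $d\times d$ real matrix, $b_v\in\mathbb{R}^d$)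 such that each bar, joining a point $a$ of $B_u$ to a point $c$ of $B_v$, satisfies $(a-c)\cdot\big((A_ua+b_u)-(A_vc+b_v)\big)=0$, and each loop $e$ at $v$ satisfies $q(e)\cdot(A_vx+b_v)=0$ for all points $x$ of $B_v$. The framework is infinitesimally rigid if its only infinitesimal motion is zero on every body.
   Formalization: Here d_X is the dimension of the linear span of {q(e): e in L(X)} minus 1 (projective dimension), not that of the affine span; with the literal affine dimension the claim fails, e.g. d=2, one vertex, two loops with q=a and 2a. *)

theory Defs
  imports "HOL-Analysis.Analysis" "HOL-Library.Disjoint_Sets"
begin

section \<open>Multigraphs with loops\<close>

record ('v, 'e, 'l) loop_graph =
  verts :: "'v set"
  edges :: "'e set"
  loops :: "'l set"
  ends :: "'e \<Rightarrow> 'v set"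
  base :: "'l \<Rightarrow> 'v"

text \<open>Parallel edges are distinct elements of type \<open>'e\<close> with the same set of ends; the elements of
  \<open>edges\<close> are the non-loop edges, hence have exactly two ends.\<close>

definition wf_loop_graph :: "('v, 'e, 'l) loop_graph \<Rightarrow> bool" where
  "wf_loop_graph G \<longleftrightarrow>
     finite (verts G) \<and> finite (edges G) \<and> finite (loops G) \<and>
     (\<forall>e\<in>edges G. ends G e \<subseteq> verts G \<and> card (ends G e) = 2) \<and>
     (\<forall>l\<in>loops G. base G l \<in> verts G)"

definition cross_count :: "('v, 'e, 'l) loop_graph \<Rightarrow> 'v set set \<Rightarrow> nat" where
  "cross_count G P =
     card {e \<in> edges G. \<exists>X\<in>P. \<exists>Y\<in>P. X \<noteq> Y \<and> ends G e \<inter> X \<noteq> {} \<and> ends G e \<inter> Y \<noteq> {}}"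

definition loops_at :: "('v, 'e, 'l) loop_graph \<Rightarrow> 'v set \<Rightarrow> 'l set" where
  "loops_at G X = {l \<in> loops G. base G l \<in> X}"


section \<open>Linearly-body-constrained body-bar frameworks\<close>

text \<open>A realisation consists of the bodies \<open>B v\<close> and the end-points \<open>p e v\<close> of the bars: the bar \<open>e\<close>
  with ends \<open>u\<close>, \<open>v\<close> joins \<open>p e u\<close> to \<open>p e v\<close>. A body is a set of points affinely spanning the whole
  space; bodies are not required to be disjoint.\<close>

definition realisation ::
  "('v, 'e, 'l) loop_graph \<Rightarrow> ('v \<Rightarrow> (real ^ 'n) set) \<Rightarrow> ('e \<Rightarrow> 'v \<Rightarrow> real ^ 'n) \<Rightarrow> bool" where
  "realisation G B p \<longleftrightarrow>
     (\<forall>v\<in>verts G. aff_dim (B v) = int CARD('n)) \<and>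
     (\<forall>e\<in>edges G. \<forall>v\<in>ends G e. p e v \<in> B v)"

definition infinitesimal_motion ::
  "('v, 'e, 'l) loop_graph \<Rightarrow> ('l \<Rightarrow> real ^ 'n) \<Rightarrow> ('v \<Rightarrow> (real ^ 'n) set) \<Rightarrow>
    ('e \<Rightarrow> 'v \<Rightarrow> real ^ 'n) \<Rightarrow> ('v \<Rightarrow> real ^ 'n ^ 'n) \<Rightarrow> ('v \<Rightarrow> real ^ 'n) \<Rightarrow> bool" where
  "infinitesimal_motion G q B p A b \<longleftrightarrow>
     (\<forall>v\<in>verts G. transpose (A v) = - A v) \<and>
     (\<forall>e\<in>edges G. \<forall>u v. ends G e = {u, v} \<longrightarrow>
        (p e u - p e v) \<bullet> ((A u *v p e u + b u) - (A v *v p e v + b v)) = 0) \<and>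
     (\<forall>l\<in>loops G. \<forall>x\<in>B (base G l). q l \<bullet> (A (base G l) *v x + b (base G l)) = 0)"

definition infinitesimally_rigid ::
  "('v, 'e, 'l) loop_graph \<Rightarrow> ('l \<Rightarrow> real ^ 'n) \<Rightarrow> ('v \<Rightarrow> (real ^ 'n) set) \<Rightarrow>
    ('e \<Rightarrow> 'v \<Rightarrow> real ^ 'n) \<Rightarrow> bool" where
  "infinitesimally_rigid G q B p \<longleftrightarrow>
     (\<forall>A b. infinitesimal_motion G q B p A b \<longrightarrow> (\<forall>v\<in>verts G. \<forall>x\<in>B v. A v *v x + b v = 0))"


section \<open>The dimension of a set of directions\<close>

text \<open>A loop constraint depends on its vector \<open>q l\<close> only up to a non-zero scalar, so the vectors
  represent points of projective space (points at infinity of the affine space), and \<open>proj_dim\<close> is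
  the dimension of the flat they span there. It agrees with the dimension of the affine hull of the
  vectors when that hull misses the origin (lemma below). The literal affine dimension must not be
  used in general: two parallel vectors, say \<open>a\<close> and \<open>2 a\<close>, impose the same constraint, but their
  affine hull is a line through the origin.\<close>

definition proj_dim :: "(real ^ 'n) set \<Rightarrow> int" where
  "proj_dim S = int (dim S) - 1"

lemma proj_dim_eq_aff_dim:
  fixes S :: "(real ^ 'n) set"
  assumes "0 \<notin> affine hull S"
  shows "proj_dim S = aff_dim S"
proof -
  have "int (dim S) = aff_dim (insert 0 S)"
    using aff_dim_zero[of "insert 0 S"] by (metis dim_span hull_inc insertI1 span_insert_0)
  also have "\<dots> = aff_dim S + 1"
    using assms by (simp add: aff_dim_insert)
  finally show ?thesis
    by (simp add: proj_dim_def)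
qed

end

theory Submission imports Defs "HOL-Library.Function_Algebras" begin

text \<open>
  An infinitesimal rigid motion of \<open>\<real>\<^sup>d\<close> is a pair \<open>(A, b)\<close> with \<open>A\<close> skew-symmetric. A loop with
  direction \<open>u\<close> on a body that spans the space says exactly \<open>A u = 0\<close> and \<open>u \<bullet> b = 0\<close>, so it is
  independent of where the body lies. Write \<open>C X\<close> for the space of motions that satisfy all loop
  constraints at the vertices of \<open>X\<close> (\<open>motions_fixing\<close>). If the directions span a space of dimension
  \<open>k\<close>, then \<open>C X\<close> consists of the rigid motions of its \<open>(d - k)\<close>-dimensional orthogonal complement
  and has dimension \<open>(d - k + 1) choose 2\<close>. This turns the counting condition into
  \<open>\<delta>(P) \<ge> (\<Sum>X\<in>P. dim (C X))\<close> for all partitions \<open>P\<close>.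

  The condition is necessary: fuse the bodies of each part \<open>X\<close> of \<open>P\<close> into one and let it move by an
  element of \<open>C X\<close>. A bar inside a part is then unaffected because \<open>A\<close> is skew, so a rigid framework
  has only the \<open>\<delta>(P)\<close> equations of the crossing bars to kill a space of dimension
  \<open>(\<Sum>X\<in>P. dim (C X))\<close>.

  It is sufficient because the bars can be placed along arbitrary lines. A bar along the line
  through \<open>a\<close> with direction \<open>r\<close> equates the values of the functional \<open>bar a r\<close> on the motions of its
  two bodies, and finitely many of these functionals separate all motions. Choosing one of them for
  each edge, so that only the zero motion survives, is a transversal problem in a vector space. Rado's
  theorem on independent transversals, stated here for kernels (\<open>rado_common_kernel\<close>), solves it
  provided that for each set \<open>F\<close> of edges the solutions of all equations on \<open>F\<close> have dimension at most
  the number of edges outside \<open>F\<close>. These solutions are constant on the parts of a partition \<open>P\<close> that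
  no edge of \<open>F\<close> crosses, so their dimension is at most \<open>(\<Sum>X\<in>P. dim (C X)) \<le> \<delta>(P)\<close>, and the
  crossing edges lie outside \<open>F\<close>.

  Assignments of motions to vertices form a function space over an arbitrary vertex type, which is not
  a Euclidean space. Hence the dimension theory is developed for finite-dimensional subspaces of an
  arbitrary real vector space.
\<close>

section \<open>Finite-dimensional subspaces of arbitrary real vector spaces\<close>

definition fin_dim :: "'a::real_vector set \<Rightarrow> bool" where
  "fin_dim S \<longleftrightarrow> (\<exists>T. finite T \<and> S \<subseteq> span T)"

lemma fin_dim_subset: "fin_dim T \<Longrightarrow> S \<subseteq> T \<Longrightarrow> fin_dim S"
  unfolding fin_dim_def by blast

lemma fin_dim_euclidean: "fin_dim (S :: 'a::euclidean_space set)"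
  unfolding fin_dim_def by (rule exI[of _ Basis]) auto

lemma fin_dim_independent:
  assumes "fin_dim S" "B \<subseteq> S" "independent B"
  shows "finite B"
  using assms independent_span_bound unfolding fin_dim_def by blast

lemma fin_dim_basis:
  assumes "subspace S" "fin_dim S"
  obtains B where "finite B" "independent B" "span B = S" "card B = dim S"
proof -
  obtain B where B: "B \<subseteq> S" "independent B" "S \<subseteq> span B" "card B = dim S"
    using basis_exists by blast
  show thesis
  proof (rule that)
    show "finite B" by (rule fin_dim_independent[OF assms(2) B(1,2)])
    show "span B = S" using span_minimal[OF B(1) assms(1)] B(3) by (rule antisym)
  qed (fact B)+
qed

lemma dim_mono_fin_dim:
  assumes "subspace T" "fin_dim T" "S \<subseteq> T"
  shows "dim S \<le> dim T"
proof -
  obtain B where "finite B" "span B = T" "card B = dim T"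
    using fin_dim_basis assms by metis
  then show ?thesis
    using dim_le_card[of S B] assms(3) by simp
qed

lemma independent_card_le_dim_fin_dim:
  assumes "subspace T" "fin_dim T" "B \<subseteq> T" "independent B"
  shows "card B \<le> dim T"
  using dim_mono_fin_dim[OF assms(1-3)] dim_eq_card_independent[OF assms(4)] by simp

lemma fin_dim_dim_0:
  assumes "subspace S" "fin_dim S" "dim S = 0"
  shows "S = {0}"
  using fin_dim_basis[OF assms(1,2)] assms(3) by (metis card_0_eq span_empty)

text \<open>The two uses: a solution space embeds into a product over the parts of a partition, and a space
  on which finitely many functionals have no common zero embeds into a coordinate space.\<close>
lemma dim_le_injective_on:
  assumes f: "linear f" and S: "subspace S" and T: "subspace T" "fin_dim T"
    and inj: "\<And>x. x \<in> S \<Longrightarrow> f x = 0 \<Longrightarrow> x = 0"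
    and ST: "f ` S \<subseteq> T"
  shows "dim S \<le> dim T"
proof -
  obtain B where B: "B \<subseteq> S" "independent B" "S \<subseteq> span B" "card B = dim S"
    using basis_exists by blast
  have spanB: "span B = S"
    using B S span_minimal by blast
  have injS: "inj_on f S"
  proof (rule inj_onI)
    fix x y assume "x \<in> S" "y \<in> S" "f x = f y"
    then have "x - y = 0"
      using inj[of "x - y"] linear_diff[OF f] S by (simp add: subspace_diff)
    then show "x = y" by simp
  qed
  have "independent (f ` B)"
    using linear_independent_injective_image[OF f B(2)] injS spanB by simp
  moreover have "card (f ` B) = card B"
    using injS B(1) by (meson card_image inj_on_subset)
  ultimately show ?thesis
    using independent_card_le_dim_fin_dim[OF T, of "f ` B"] ST B by auto
qed

text \<open>The half of the modular law for dimensions that makes ``codimension of the common kernel'' a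
  submodular function of a set of functionals. A basis of \<open>P \<inter> Q\<close> is extended to bases of \<open>P\<close> and
  of \<open>Q\<close>; their union is independent and lies in \<open>R\<close>.\<close>
lemma dim_add_le_dim_Int_add:
  assumes P: "subspace P" and Q: "subspace Q" and R: "subspace R" "fin_dim R"
    and sub: "P \<subseteq> R" "Q \<subseteq> R"
  shows "dim P + dim Q \<le> dim (P \<inter> Q) + dim R"
proof -
  have fd: "fin_dim P" "fin_dim Q" "fin_dim (P \<inter> Q)"
    using fin_dim_subset[OF R(2)] sub by blast+
  obtain B0 where B0: "finite B0" "independent B0" "span B0 = P \<inter> Q" "card B0 = dim (P \<inter> Q)"
    using fin_dim_basis[OF subspace_inter[OF P Q] fd(3)] .
  obtain B1 where B1: "B0 \<subseteq> B1" "B1 \<subseteq> P" "independent B1" "P \<subseteq> span B1"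
    using maximal_independent_subset_extend[of B0 P] B0 span_superset[of B0] by blast
  obtain B2 where B2: "B0 \<subseteq> B2" "B2 \<subseteq> Q" "independent B2" "Q \<subseteq> span B2"
    using maximal_independent_subset_extend[of B0 Q] B0 span_superset[of B0] by blast
  have sp: "span B1 = P" "span B2 = Q"
    using B1 B2 P Q span_minimal by blast+
  have card: "card B1 = dim P" "card B2 = dim Q"
    using dim_eq_card_independent[OF B1(3)] dim_eq_card_independent[OF B2(3)] dim_span[of B1]
      dim_span[of B2] sp by auto
  have fin: "finite B1" "finite B2"
    using fin_dim_independent fd B1 B2 by blast+
  have disj: "(B2 - B0) \<inter> B1 = {}"
  proof -
    have False if x: "x \<in> B2" "x \<notin> B0" "x \<in> B1" for x
    proof -
      have "x \<in> span B0" using x B1 B2 B0 by blast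
      then have "x \<in> span (B2 - {x})"
        using span_mono[of B0 "B2 - {x}"] B2(1) x by blast
      then show False using B2(3) x(1) unfolding dependent_def by blast
    qed
    then show ?thesis by blast
  qed
  \<comment> \<open>A vector of \<open>B2\<close> that depends on \<open>B1\<close> and other vectors of \<open>B2\<close> differs from a combination of
    the latter by an element of \<open>P \<inter> Q\<close>, so it already depends on the rest of \<open>B2\<close>.\<close>
  have indep: "independent (B1 \<union> D)" if "D \<subseteq> B2 - B0" for D
  proof -
    have "finite D" using that fin finite_subset by blast
    then show ?thesis using that
    proof (induction D rule: finite_induct)
      case (insert a D)
      have a: "a \<in> B2" "a \<notin> B0" using insert by auto
      have "a \<notin> span (B1 \<union> D)"
      proof
        assume "a \<in> span (B1 \<union> D)"
        then obtain p s where ps: "a = p + s" "p \<in> P" "s \<in> span D"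
          unfolding span_Un sp by blast
        have sQ: "s \<in> Q"
          using ps(3) insert.prems B2(2) span_minimal[OF _ Q, of D] by blast
        have "p = a - s" using ps by simp
        then have "p \<in> Q" using sQ a B2(2) Q by (auto intro: subspace_diff)
        then have "p \<in> span B0" using ps B0 by blast
        moreover have "B0 \<subseteq> B2 - {a}" "D \<subseteq> B2 - {a}" using insert B2(1) a by auto
        ultimately have "p \<in> span (B2 - {a})" "s \<in> span (B2 - {a})"
          using ps(3) span_mono by blast+
        then have "a \<in> span (B2 - {a})" using ps(1) span_add by blast
        then show False using B2(3) a(1) unfolding dependent_def by blast
      qed
      then show ?case using insert by (simp add: independent_insertI)
    qed (use B1 in simp)
  qed
  have "card (B1 \<union> (B2 - B0)) \<le> dim R"
    using independent_card_le_dim_fin_dim[OF R, of "B1 \<union> (B2 - B0)"] indep[of "B2 - B0"] B1 B2 sub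
    by blast
  moreover have "card (B1 \<union> (B2 - B0)) = card B1 + (card B2 - card B0)"
    using card_Un_disjoint[of B1 "B2 - B0"] disj fin B0(1) B2(1) by (simp add: card_Diff_subset Int_commute)
  moreover have "card B0 \<le> card B2" using B2(1) fin card_mono by blast
  ultimately show ?thesis using card B0(4) by linarith
qed

section \<open>Spaces of families of vectors\<close>

instantiation "fun" :: (type, real_vector) real_vector
begin

definition "scaleR_fun c f = (\<lambda>x. c *\<^sub>R f x)"

instance
  by standard (auto simp: scaleR_fun_def fun_eq_iff algebra_simps)

end

lemma scaleR_fun_apply [simp]: "(c *\<^sub>R f) x = c *\<^sub>R f x"
  by (simp add: scaleR_fun_def)

text \<open>The value \<open>0\<close> outside \<open>I\<close> makes a family determined by its restriction to \<open>I\<close>; this is what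
  keeps the space finite-dimensional.\<close>
definition product_space :: "'i set \<Rightarrow> ('i \<Rightarrow> 'a::real_vector set) \<Rightarrow> ('i \<Rightarrow> 'a) set" where
  "product_space I C = {f. (\<forall>i\<in>I. f i \<in> C i) \<and> (\<forall>i. i \<notin> I \<longrightarrow> f i = 0)}"

lemma subspace_product_space:
  assumes "\<And>i. i \<in> I \<Longrightarrow> subspace (C i)"
  shows "subspace (product_space I C)"
  using assms by (auto simp: product_space_def subspace_def)

definition single :: "'i \<Rightarrow> 'a::real_vector \<Rightarrow> 'i \<Rightarrow> 'a" where
  "single i c = (\<lambda>j. if j = i then c else 0)"

lemma linear_single: "linear (single i)"
  by (rule linearI) (auto simp: single_def fun_eq_iff)

lemma product_space_in_span:
  fixes C :: "'i \<Rightarrow> 'a::real_vector set"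
  assumes "finite I" and f: "f \<in> product_space I C"
    and B: "\<And>i. i \<in> I \<Longrightarrow> C i \<subseteq> span (B i)"
  shows "f \<in> span (\<Union>i\<in>I. single i ` B i)"
proof -
  have "f = (\<Sum>i\<in>I. single i (f i))"
  proof
    fix j
    have "(\<Sum>i\<in>J. single i (f i)) j = (if j \<in> J then f j else 0)" if "finite J" for J
      using that by (induction J rule: finite_induct) (auto simp: single_def)
    then show "f j = (\<Sum>i\<in>I. single i (f i)) j"
      using f assms(1) by (auto simp: product_space_def)
  qed
  also have "\<dots> \<in> span (\<Union>i\<in>I. single i ` B i)"
  proof (rule span_sum)
    fix i assume i: "i \<in> I"
    then have "f i \<in> span (B i)"
      using f B by (auto simp: product_space_def)
    then have "single i (f i) \<in> span (single i ` B i)"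
      using linear_span_image[OF linear_single, of i "B i"] by blast
    then show "single i (f i) \<in> span (\<Union>i\<in>I. single i ` B i)"
      using i span_mono[of "single i ` B i" "\<Union>i\<in>I. single i ` B i"] by blast
  qed
  finally show ?thesis .
qed

lemma
  fixes C :: "'i \<Rightarrow> 'a::euclidean_space set"
  assumes fin: "finite I" and sub: "\<And>i. i \<in> I \<Longrightarrow> subspace (C i)"
  shows fin_dim_product_space: "fin_dim (product_space I C)"
    and dim_product_space: "dim (product_space I C) = (\<Sum>i\<in>I. dim (C i))"
proof -
  have "\<exists>B. finite B \<and> C i \<subseteq> span B \<and> card B = dim (C i)" if "i \<in> I" for i
    using fin_dim_basis[OF sub[OF that] fin_dim_euclidean] by (metis order_refl)
  then obtain B where B: "\<And>i. i \<in> I \<Longrightarrow> finite (B i)" "\<And>i. i \<in> I \<Longrightarrow> C i \<subseteq> span (B i)"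
      "\<And>i. i \<in> I \<Longrightarrow> card (B i) = dim (C i)"
    by metis
  define T where "T = (\<Union>i\<in>I. single i ` B i)"
  have T: "finite T" using fin B(1) by (simp add: T_def)
  have span: "product_space I C \<subseteq> span T"
    using product_space_in_span[where C = C and B = B, OF fin _ B(2)] unfolding T_def by blast
  show "fin_dim (product_space I C)"
    using T span unfolding fin_dim_def by blast
  have "dim (product_space I C) \<le> card T"
    using span T by (rule dim_le_card)
  also have "\<dots> \<le> (\<Sum>i\<in>I. card (single i ` B i))"
    unfolding T_def using fin by (rule card_UN_le)
  also have "\<dots> \<le> (\<Sum>i\<in>I. dim (C i))"
  proof (rule sum_mono)
    fix i assume "i \<in> I"
    then show "card (single i ` B i) \<le> dim (C i)"
      using card_image_le[OF B(1), of i "single i"] B(3) by simp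
  qed
  finally have le: "dim (product_space I C) \<le> (\<Sum>i\<in>I. dim (C i))" .
  \<comment> \<open>Conversely, the families supported at \<open>i\<close> and those supported on \<open>J\<close> meet only in zero, so the
    dimensions of the factors add up.\<close>
  have "(\<Sum>i\<in>J. dim (C i)) \<le> dim (product_space J C)" if "J \<subseteq> I" for J
  proof -
    have "finite J" using that fin finite_subset by blast
    then show ?thesis using that
    proof (induction J rule: finite_induct)
      case (insert i J)
      let ?R = "product_space (insert i J) C"
      have zero: "0 \<in> C j" if "j \<in> insert i J" for j
        using that sub insert.prems by (meson subsetD subspace_0)
      have Rsub: "subspace ?R" "subspace (product_space {i} C)" "subspace (product_space J C)"
        by (rule subspace_product_space, use sub insert.prems in blast)+
      have Rfd: "fin_dim ?R"
      proof (rule fin_dim_subset)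
        show "fin_dim (product_space I C)" using span T unfolding fin_dim_def by blast
        show "?R \<subseteq> product_space I C"
        proof
          fix f assume f: "f \<in> ?R"
          have "f j \<in> C j" if "j \<in> I" for j
            using f subspace_0[OF sub[OF that]]
            by (cases "j \<in> insert i J") (auto simp: product_space_def)
          then show "f \<in> product_space I C"
            using f insert.prems unfolding product_space_def by blast
        qed
      qed
      have PQ: "product_space {i} C \<subseteq> ?R" "product_space J C \<subseteq> ?R"
      proof -
        show "product_space {i} C \<subseteq> ?R"
        proof
          fix f assume f: "f \<in> product_space {i} C"
          have "f j \<in> C j" if "j \<in> insert i J" for j
            using f zero[OF that] by (cases "j = i") (auto simp: product_space_def)
          then show "f \<in> ?R" using f by (auto simp: product_space_def)
        qed
        show "product_space J C \<subseteq> ?R"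
        proof
          fix f assume f: "f \<in> product_space J C"
          have "f j \<in> C j" if "j \<in> insert i J" for j
            using f zero[OF that] by (cases "j \<in> J") (auto simp: product_space_def)
          then show "f \<in> ?R" using f by (auto simp: product_space_def)
        qed
      qed
      have "dim (C i) \<le> dim (product_space {i} C)"
      proof (rule dim_le_injective_on[OF linear_single[of i]])
        show "subspace (C i)" using sub insert.prems by blast
        show "subspace (product_space {i} C)" by (fact Rsub)
        show "fin_dim (product_space {i} C)" using Rfd PQ(1) by (rule fin_dim_subset)
        show "x = 0" if "single i x = 0" for x :: 'a
          using fun_cong[OF that, of i] by (simp add: single_def)
        show "single i ` C i \<subseteq> product_space {i} C"
          by (auto simp: product_space_def single_def)
      qed
      moreover have "product_space {i} C \<inter> product_space J C \<subseteq> {0}"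
      proof
        fix f assume f: "f \<in> product_space {i} C \<inter> product_space J C"
        have "f j = 0" for j
          using f insert.hyps by (cases "j = i") (auto simp: product_space_def)
        then show "f \<in> {0}" by (simp add: fun_eq_iff)
      qed
      then have "dim (product_space {i} C \<inter> product_space J C) = 0"
        using dim_le_card[of _ "{}"] by simp
      moreover note dim_add_le_dim_Int_add[OF Rsub(2,3,1) Rfd PQ] insert.IH insert.prems
      ultimately show ?case using insert.hyps by simp
    qed simp
  qed
  then show "dim (product_space I C) = (\<Sum>i\<in>I. dim (C i))"
    using le by (simp add: antisym)
qed

lemma dim_le_card_functionals:
  fixes \<phi> :: "'e \<Rightarrow> 'a::real_vector \<Rightarrow> real"
  assumes N: "subspace N" and E: "finite E"
    and lin: "\<And>e. e \<in> E \<Longrightarrow> linear (\<phi> e)"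
    and inj: "\<And>x. x \<in> N \<Longrightarrow> (\<And>e. e \<in> E \<Longrightarrow> \<phi> e x = 0) \<Longrightarrow> x = 0"
  shows "dim N \<le> card E"
proof -
  define f where "f x = (\<lambda>e. if e \<in> E then \<phi> e x else 0)" for x
  have "linear f"
    using lin by (intro linearI) (auto simp: f_def fun_eq_iff linear_add linear_scale)
  moreover have "x = 0" if "x \<in> N" "f x = 0" for x
    using that inj[of x] unfolding f_def fun_eq_iff by (metis zero_fun_apply)
  moreover have "f ` N \<subseteq> product_space E (\<lambda>_. UNIV)"
    by (auto simp: f_def product_space_def)
  ultimately have "dim N \<le> dim (product_space E (\<lambda>_. UNIV :: real set))"
    using N E by (intro dim_le_injective_on) (auto intro: subspace_product_space fin_dim_product_space)
  then show ?thesis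
    using dim_product_space[OF E, of "\<lambda>_. UNIV :: real set"] by simp
qed

section \<open>A transversal theorem of Rado for common kernels\<close>

definition common_kernel :: "'a::real_vector set \<Rightarrow> ('a \<Rightarrow> real) set \<Rightarrow> 'a set" where
  "common_kernel N \<Phi> = {x \<in> N. \<forall>\<phi>\<in>\<Phi>. \<phi> x = 0}"

lemma subspace_common_kernel:
  assumes "subspace N" "\<And>\<phi>. \<phi> \<in> \<Phi> \<Longrightarrow> linear \<phi>"
  shows "subspace (common_kernel N \<Phi>)"
  using assms by (auto simp: common_kernel_def subspace_def linear_0 linear_add linear_scale)

text \<open>Rado's theorem with deficiency, for the linear matroid of functionals on \<open>N\<close>. As in the
  standard proof, the sets \<open>K e\<close> are shrunk one element at a time without violating the dimension
  condition. When all are singletons, the condition for \<open>F = E\<close> is the conclusion. If removing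
  \<open>\<phi>\<close> and removing \<open>\<psi>\<close> from the same set both violated it, at \<open>insert e0 F\<close> and \<open>insert e0 F'\<close>, then
  submodularity would contradict the condition for \<open>insert e0 (F \<union> F')\<close> and \<open>F \<inter> F'\<close>.\<close>
theorem rado_common_kernel:
  fixes N :: "'a::real_vector set" and K :: "'e \<Rightarrow> ('a \<Rightarrow> real) set"
  assumes N: "subspace N" "fin_dim N" and E: "finite E"
    and K: "\<And>e. e \<in> E \<Longrightarrow> finite (K e)" "\<And>e. e \<in> E \<Longrightarrow> K e \<noteq> {}"
    and lin: "\<And>e \<phi>. e \<in> E \<Longrightarrow> \<phi> \<in> K e \<Longrightarrow> linear \<phi>"
    and dims: "\<And>F. F \<subseteq> E \<Longrightarrow> dim (common_kernel N (\<Union>(K ` F))) \<le> card (E - F)"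
  shows "\<exists>k. (\<forall>e\<in>E. k e \<in> K e) \<and> (\<forall>x\<in>N. (\<forall>e\<in>E. k e x = 0) \<longrightarrow> x = 0)"
  using K lin dims
proof (induction "\<Sum>e\<in>E. card (K e)" arbitrary: K rule: less_induct)
  case less
  show ?case
  proof (cases "\<exists>e\<in>E. \<exists>\<phi>\<in>K e. \<exists>\<psi>\<in>K e. \<phi> \<noteq> \<psi>")
    case False
    have "\<exists>k. \<forall>e\<in>E. k e \<in> K e" using less.prems(2) by (intro bchoice) blast
    then obtain k where k: "\<forall>e\<in>E. k e \<in> K e" by blast
    with False have Kk: "K e = {k e}" if "e \<in> E" for e
      using that by (intro equalityI subsetI) auto
    let ?Z = "common_kernel N (\<Union>(K ` E))"
    have "subspace ?Z"
      using subspace_common_kernel[OF N(1)] less.prems(3) by blast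
    moreover have "fin_dim ?Z"
      using N(2) by (rule fin_dim_subset) (auto simp: common_kernel_def)
    moreover have "dim ?Z = 0" using less.prems(4)[of E] by simp
    ultimately have "?Z = {0}" by (rule fin_dim_dim_0)
    then have "\<forall>x\<in>N. (\<forall>e\<in>E. k e x = 0) \<longrightarrow> x = 0"
      using Kk unfolding common_kernel_def by force
    then show ?thesis using k by blast
  next
    case True
    then obtain e0 \<phi> \<psi> where e0: "e0 \<in> E" "\<phi> \<in> K e0" "\<psi> \<in> K e0" "\<phi> \<noteq> \<psi>" by blast
    define K' where "K' \<omega> = K(e0 := K e0 - {\<omega>})" for \<omega>
    \<comment> \<open>\<open>F\<close> shows that \<open>\<omega>\<close> cannot be removed: the condition then fails at \<open>insert e0 F\<close>, for which
      \<open>card (E - insert e0 F) = card (E - F) - 1\<close>.\<close>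
    define bad where "bad \<omega> F \<longleftrightarrow> F \<subseteq> E - {e0} \<and>
      card (E - F) \<le> dim (common_kernel N (\<Union>(K ` F) \<union> (K e0 - {\<omega>})))" for \<omega> F
    have step: ?thesis if chi: "\<omega> \<in> K e0" "K e0 - {\<omega>} \<noteq> {}" and good: "\<nexists>F. bad \<omega> F" for \<omega>
    proof -
      have lt: "(\<Sum>e\<in>E. card (K' \<omega> e)) < (\<Sum>e\<in>E. card (K e))"
      proof (rule sum_strict_mono_ex1[OF E])
        show "\<forall>e\<in>E. card (K' \<omega> e) \<le> card (K e)"
          using less.prems(1) by (auto simp: K'_def card_Diff_subset intro: card_mono)
        show "\<exists>e\<in>E. card (K' \<omega> e) < card (K e)"
        proof (rule bexI[OF _ e0(1)])
          show "card (K' \<omega> e0) < card (K e0)"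
            using card_Diff1_less[OF less.prems(1)[OF e0(1)] chi(1)] by (simp add: K'_def)
        qed
      qed
      have dims': "dim (common_kernel N (\<Union>(K' \<omega> ` F))) \<le> card (E - F)" if F: "F \<subseteq> E" for F
      proof (cases "e0 \<in> F")
        case False
        then have "K' \<omega> ` F = K ` F" by (auto simp: K'_def)
        then show ?thesis using less.prems(4)[OF F] by simp
      next
        case e0F: True
        have eq: "\<Union>(K' \<omega> ` F) = \<Union>(K ` (F - {e0})) \<union> (K e0 - {\<omega>})"
          using e0F by (auto simp: K'_def split: if_splits)
        have "E - (F - {e0}) = insert e0 (E - F)" using F e0 e0F by blast
        then have "card (E - (F - {e0})) = Suc (card (E - F))"
          using E e0F by simp
        moreover have "\<not> bad \<omega> (F - {e0})" using good by blast
        ultimately show ?thesis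
          using F unfolding bad_def eq by auto
      qed
      have "\<exists>k. (\<forall>e\<in>E. k e \<in> K' \<omega> e) \<and> (\<forall>x\<in>N. (\<forall>e\<in>E. k e x = 0) \<longrightarrow> x = 0)"
      proof (rule less.hyps[OF lt])
        show "finite (K' \<omega> e)" "K' \<omega> e \<noteq> {}" if "e \<in> E" for e
          using less.prems(1,2)[OF that] chi by (auto simp: K'_def)
        show "linear \<xi>" if "e \<in> E" "\<xi> \<in> K' \<omega> e" for e \<xi>
          using less.prems(3)[OF that(1)] that(2) by (auto simp: K'_def split: if_splits)
      qed (fact dims')
      then obtain k where k: "\<forall>e\<in>E. k e \<in> K' \<omega> e" "\<forall>x\<in>N. (\<forall>e\<in>E. k e x = 0) \<longrightarrow> x = 0"
        by (elim exE conjE)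
      have "K' \<omega> e \<subseteq> K e" for e by (auto simp: K'_def)
      then have "\<forall>e\<in>E. k e \<in> K e" using k(1) by (meson subsetD)
      then show ?thesis using k(2) by (intro exI[of _ k] conjI)
    qed
    have "\<not> (bad \<phi> F \<and> bad \<psi> F')" for F F'
    proof
      assume bad: "bad \<phi> F \<and> bad \<psi> F'"
      let ?P = "common_kernel N (\<Union>(K ` F) \<union> (K e0 - {\<phi>}))"
      let ?Q = "common_kernel N (\<Union>(K ` F') \<union> (K e0 - {\<psi>}))"
      let ?R = "common_kernel N (\<Union>(K ` (F \<inter> F')))"
      have FF: "F \<subseteq> E - {e0}" "F' \<subseteq> E - {e0}" using bad by (auto simp: bad_def)
      have sub: "subspace ?P" "subspace ?Q" "subspace ?R"
        by (rule subspace_common_kernel[OF N(1)], use less.prems(3) FF e0(1) in blast)+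
      have Rfd: "fin_dim ?R"
        using N(2) by (rule fin_dim_subset) (auto simp: common_kernel_def)
      have "dim ?P + dim ?Q \<le> dim (?P \<inter> ?Q) + dim ?R"
        by (rule dim_add_le_dim_Int_add[OF sub Rfd]) (auto simp: common_kernel_def)
      moreover have "?P \<inter> ?Q = common_kernel N (\<Union>(K ` (insert e0 (F \<union> F'))))"
        using e0 by (auto simp: common_kernel_def)
      then have "dim (?P \<inter> ?Q) \<le> card (E - insert e0 (F \<union> F'))"
        using less.prems(4)[of "insert e0 (F \<union> F')"] FF e0(1) by auto
      moreover have "card (E - insert e0 (F \<union> F')) < card (E - (F \<union> F'))"
        using E e0 FF by (intro psubset_card_mono) auto
      moreover have "dim ?R \<le> card (E - (F \<inter> F'))"
        using FF by (intro less.prems(4)) auto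
      moreover have "card (E - (F \<union> F')) + card (E - (F \<inter> F')) = card (E - F) + card (E - F')"
        using card_Un_Int[of "E - F" "E - F'"] E by (simp add: Diff_Un Diff_Int)
      moreover have "card (E - F) \<le> dim ?P" "card (E - F') \<le> dim ?Q"
        using bad by (auto simp: bad_def)
      ultimately show False by linarith
    qed
    then have "(\<nexists>F. bad \<phi> F) \<or> (\<nexists>F. bad \<psi> F)" by blast
    then show ?thesis using step[of \<phi>] step[of \<psi>] e0 by blast
  qed
qed

section \<open>One functional for each edge of a graph\<close>

text \<open>The linear-algebra core of sufficiency. It applies to any spaces \<open>C v\<close> attached to the vertices
  and any finite stock \<open>K\<close> of functionals that separates their elements: an edge whose ends take
  different values can be detected by some element of \<open>K\<close>, and Rado's theorem makes all these choices
  at once.\<close>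
lemma separating_family_on_edges:
  fixes C :: "'v \<Rightarrow> 'a::euclidean_space set" and s t :: "'e \<Rightarrow> 'v"
    and K :: "('a \<Rightarrow> real) set"
  assumes V: "finite V" and E: "finite E" and st: "\<And>e. e \<in> E \<Longrightarrow> s e \<in> V" "\<And>e. e \<in> E \<Longrightarrow> t e \<in> V"
    and C: "\<And>v. v \<in> V \<Longrightarrow> subspace (C v)"
    and K: "finite K" "K \<noteq> {}" "\<And>\<phi>. \<phi> \<in> K \<Longrightarrow> linear \<phi>"
    and sep: "\<And>u v x y. u \<in> V \<Longrightarrow> v \<in> V \<Longrightarrow> x \<in> C u \<Longrightarrow> y \<in> C v \<Longrightarrow>
      (\<And>\<phi>. \<phi> \<in> K \<Longrightarrow> \<phi> x = \<phi> y) \<Longrightarrow> x = y"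
    and count: "\<And>P. partition_on V P \<Longrightarrow>
      (\<Sum>X\<in>P. dim (\<Inter>v\<in>X. C v)) \<le> card {e \<in> E. \<not> (\<exists>X\<in>P. s e \<in> X \<and> t e \<in> X)}"
  shows "\<exists>k. (\<forall>e\<in>E. k e \<in> K) \<and>
    (\<forall>S. (\<forall>v\<in>V. S v \<in> C v) \<and> (\<forall>e\<in>E. k e (S (s e)) = k e (S (t e))) \<longrightarrow> (\<forall>v\<in>V. S v = 0))"
proof -
  define N where "N = product_space V C"
  define row where "row e \<phi> = (\<lambda>S. \<phi> (S (s e)) - \<phi> (S (t e)))" for e :: 'e and \<phi> :: "'a \<Rightarrow> real"
  have N: "subspace N" "fin_dim N"
    unfolding N_def using C by (auto intro: subspace_product_space fin_dim_product_space[OF V])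
  have lin: "linear (row e \<phi>)" if "\<phi> \<in> K" for e \<phi>
    using K(3)[OF that] by (intro linearI) (auto simp: row_def linear_add linear_scale algebra_simps)
  have dims: "dim (common_kernel N (\<Union>e\<in>F. row e ` K)) \<le> card (E - F)" if F: "F \<subseteq> E" for F
  proof -
    define Z where "Z = common_kernel N (\<Union>e\<in>F. row e ` K)"
    have Z: "subspace Z" unfolding Z_def
      by (rule subspace_common_kernel[OF N(1)]) (use lin in blast)
    have ZC: "S v \<in> C v" if "S \<in> Z" "v \<in> V" for S v
      using that unfolding Z_def common_kernel_def N_def product_space_def by blast
    \<comment> \<open>Grouping the vertices by equality under all solutions, rather than by connectivity in \<open>F\<close>,
      makes solutions constant on the parts at once; \<open>sep\<close> shows that no edge of \<open>F\<close> crosses.\<close>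
    define r where "r = {(u, v). u \<in> V \<and> v \<in> V \<and> (\<forall>S\<in>Z. S u = S v)}"
    have "equiv V r"
      by (rule equivI) (auto simp: r_def refl_on_def sym_def trans_def)
    define P where "P = V // r"
    have P: "partition_on V P"
      unfolding P_def by (rule partition_on_quotient) fact
    have PV: "X \<subseteq> V" if "X \<in> P" for X
      using that P by (auto simp: partition_on_def)
    have finP: "finite P" using finite_elements[OF V P] .
    have same: "S u = S v" if "X \<in> P" "u \<in> X" "v \<in> X" "S \<in> Z" for X u v S
    proof -
      obtain x where "X = r `` {x}" using \<open>X \<in> P\<close> unfolding P_def by (rule quotientE)
      then have "S x = S u" "S x = S v" using that unfolding r_def by blast+
      then show ?thesis by (rule trans[OF sym])
    qed
    define D where "D X = (\<Inter>v\<in>X. C v)" for X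
    have subD: "subspace (D X)" if "X \<in> P" for X
      unfolding D_def using PV[OF that] C by (intro subspace_Inter) auto
    define h where "h S = (\<lambda>X. if X \<in> P then S (SOME v. v \<in> X) else 0)" for S :: "'v \<Rightarrow> 'a"
    have some: "(SOME v. v \<in> X) \<in> X" if "X \<in> P" for X
      using that P by (auto simp: partition_on_def some_in_eq)
    have "dim Z \<le> dim (product_space P D)"
    proof (rule dim_le_injective_on)
      show "linear h" by (intro linearI) (auto simp: h_def fun_eq_iff)
      show "subspace (product_space P D)" "fin_dim (product_space P D)"
        using subD by (auto intro: subspace_product_space fin_dim_product_space[OF finP])
      show "S = 0" if S: "S \<in> Z" "h S = 0" for S
      proof
        fix v
        show "S v = 0 v"
        proof (cases "v \<in> V")
          case True
          then obtain X where X: "X \<in> P" "v \<in> X" using P by (auto simp: partition_on_def)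
          have "S v = S (SOME v. v \<in> X)" using same[OF X some[OF X(1)] S(1)] .
          also have "\<dots> = h S X" using X(1) by (simp add: h_def)
          finally show ?thesis using S(2) by simp
        next
          case False
          then show ?thesis
            using S(1) by (simp add: Z_def common_kernel_def N_def product_space_def)
        qed
      qed
      have "S (SOME v. v \<in> X) \<in> D X" if "S \<in> Z" "X \<in> P" for S X
        unfolding D_def
      proof
        fix v assume v: "v \<in> X"
        show "S (SOME v. v \<in> X) \<in> C v"
          using same[OF that(2) some[OF that(2)] v that(1)] ZC[OF that(1), of v] PV[OF that(2)] v by auto
      qed
      then show "h ` Z \<subseteq> product_space P D"
        by (auto simp: h_def product_space_def)
    qed (fact Z)
    also have "\<dots> = (\<Sum>X\<in>P. dim (D X))"
      using subD by (rule dim_product_space[OF finP])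
    also have "\<dots> \<le> card {e \<in> E. \<not> (\<exists>X\<in>P. s e \<in> X \<and> t e \<in> X)}"
      unfolding D_def by (rule count[OF P])
    also have "\<dots> \<le> card (E - F)"
    proof (rule card_mono)
      show "finite (E - F)" using E by simp
      have "\<exists>X\<in>P. s e \<in> X \<and> t e \<in> X" if e: "e \<in> F" for e
      proof -
        have eE: "e \<in> E" using F e by blast
        have "S (s e) = S (t e)" if "S \<in> Z" for S
        proof (rule sep[OF st[OF eE] ZC[OF that st(1)[OF eE]] ZC[OF that st(2)[OF eE]]])
          fix \<phi> assume "\<phi> \<in> K"
          then have "row e \<phi> S = 0"
            using that e unfolding Z_def common_kernel_def by blast
          then show "\<phi> (S (s e)) = \<phi> (S (t e))" by (simp add: row_def)
        qed
        then have "(s e, t e) \<in> r" "(s e, s e) \<in> r" using st[OF eE] by (auto simp: r_def)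
        then show ?thesis
          using st(1)[OF eE] unfolding P_def by (intro bexI[of _ "r `` {s e}"] quotientI) auto
      qed
      then show "{e \<in> E. \<not> (\<exists>X\<in>P. s e \<in> X \<and> t e \<in> X)} \<subseteq> E - F" by blast
    qed
    finally show ?thesis unfolding Z_def .
  qed
  have "\<exists>k. (\<forall>e\<in>E. k e \<in> row e ` K) \<and> (\<forall>x\<in>N. (\<forall>e\<in>E. k e x = 0) \<longrightarrow> x = 0)"
  proof (rule rado_common_kernel[OF N E])
    show "finite (row e ` K)" "row e ` K \<noteq> {}" for e using K by auto
    show "linear \<phi>" if "\<phi> \<in> row e ` K" for e \<phi> using lin that by auto
  qed (fact dims)
  then obtain k' where k': "\<forall>e\<in>E. k' e \<in> row e ` K"
    and inj: "\<forall>x\<in>N. (\<forall>e\<in>E. k' e x = 0) \<longrightarrow> x = 0" by (elim exE conjE)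
  have "\<forall>e\<in>E. \<exists>\<phi>. \<phi> \<in> K \<and> k' e = row e \<phi>" using k' by blast
  then obtain k where k: "\<forall>e\<in>E. k e \<in> K \<and> k' e = row e (k e)" by (rule bchoice[THEN exE])
  have "\<forall>v\<in>V. S v = 0"
    if S: "\<forall>v\<in>V. S v \<in> C v" "\<forall>e\<in>E. k e (S (s e)) = k e (S (t e))" for S
  proof -
    define S' where "S' = (\<lambda>v. if v \<in> V then S v else 0)"
    have "S' \<in> N" using S(1) by (simp add: N_def product_space_def S'_def)
    moreover have "k' e S' = 0" if "e \<in> E" for e
      using that k S(2) st[OF that] by (simp add: row_def S'_def)
    ultimately have "S' = 0" using inj by blast
    then show ?thesis unfolding S'_def fun_eq_iff by (metis zero_fun_apply)
  qed
  then show ?thesis using k by blast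
qed

section \<open>Infinitesimal rigid motions annihilating a set of directions\<close>

text \<open>The infinitesimal rigid motions of a body allowed by loops with the directions \<open>U\<close>.\<close>
definition motions_fixing :: "(real ^ 'n) set \<Rightarrow> ((real ^ 'n ^ 'n) \<times> (real ^ 'n)) set" where
  "motions_fixing U = {(A, b). transpose A = - A \<and> (\<forall>u\<in>U. A *v u = 0 \<and> u \<bullet> b = 0)}"

lemma skew_inner:
  fixes A :: "real ^ 'n ^ 'n"
  assumes "transpose A = - A"
  shows "x \<bullet> (A *v y) = - ((A *v x) \<bullet> y)"
proof -
  have "x \<bullet> (A *v y) = (transpose A *v x) \<bullet> y"
    by (simp add: dot_lmul_matrix)
  also have "\<dots> = - ((A *v x) \<bullet> y)"
    using assms by (simp add: matrix_vector_mult_def inner_vec_def sum_negf)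
  finally show ?thesis .
qed

lemma skew_inner_self:
  fixes A :: "real ^ 'n ^ 'n"
  assumes "transpose A = - A"
  shows "x \<bullet> (A *v x) = 0"
  using skew_inner[OF assms, of x x] by (simp add: inner_commute)

lemma transpose_add: "transpose (A + B) = transpose A + transpose (B :: real ^ 'n ^ 'm)"
  by (simp add: transpose_def vec_eq_iff)

lemma subspace_motions_fixing:
  fixes U :: "(real ^ 'n) set"
  shows "subspace (motions_fixing U)"
proof (rule subspaceI)
  show "0 \<in> motions_fixing U"
    by (simp add: motions_fixing_def zero_prod_def transpose_def vec_eq_iff)
next
  fix S S' :: "(real ^ 'n ^ 'n) \<times> (real ^ 'n)"
  assume "S \<in> motions_fixing U" "S' \<in> motions_fixing U"
  then show "S + S' \<in> motions_fixing U"
    by (cases S; cases S')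
      (simp add: motions_fixing_def transpose_add matrix_vector_mult_add_rdistrib inner_add_right)
next
  fix c and S :: "(real ^ 'n ^ 'n) \<times> (real ^ 'n)"
  assume "S \<in> motions_fixing U"
  then show "c *\<^sub>R S \<in> motions_fixing U"
    by (cases S) (simp add: motions_fixing_def transpose_scalar scaleR_matrix_vector_assoc[symmetric])
qed

text \<open>Only the span of the loop directions matters, which is why the projective dimension is the right
  parameter in the counting condition.\<close>
lemma motions_fixing_span: "motions_fixing (span U) = motions_fixing U"
proof
  show "motions_fixing (span U) \<subseteq> motions_fixing U"
    using span_superset[of U] unfolding motions_fixing_def by blast
  show "motions_fixing U \<subseteq> motions_fixing (span U)"
  proof
    fix S assume S: "S \<in> motions_fixing U"
    obtain A b where Ab: "S = (A, b)" by (cases S)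
    have "U \<subseteq> {u. A *v u = 0 \<and> u \<bullet> b = 0}" using S by (auto simp: motions_fixing_def Ab)
    moreover have "subspace {u. A *v u = 0 \<and> u \<bullet> b = 0}"
      by (auto simp: subspace_def matrix_vector_right_distrib matrix_vector_mult_scaleR inner_add_left)
    ultimately have "span U \<subseteq> {u. A *v u = 0 \<and> u \<bullet> b = 0}" by (rule span_minimal)
    then show "S \<in> motions_fixing (span U)"
      using S by (auto simp: motions_fixing_def Ab)
  qed
qed

lemma motions_fixing_Union:
  assumes "X \<noteq> {}"
  shows "(\<Inter>v\<in>X. motions_fixing (U v)) = motions_fixing (\<Union>v\<in>X. U v)"
  using assms by (auto simp: motions_fixing_def)

text \<open>Rank-nullity for a linear map with an explicit section, which spares computing its image.\<close>
lemma dim_eq_dim_kernel_add: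
  fixes f :: "'a::euclidean_space \<Rightarrow> 'b::euclidean_space"
  assumes f: "linear f" and g: "linear g" and N: "subspace N" and Y: "subspace Y"
    and fN: "\<And>x. x \<in> N \<Longrightarrow> f x \<in> Y" and gY: "\<And>y. y \<in> Y \<Longrightarrow> g y \<in> N"
    and fg: "\<And>y. y \<in> Y \<Longrightarrow> f (g y) = y"
  shows "dim N = dim {x \<in> N. f x = 0} + dim Y"
proof -
  let ?M = "{x \<in> N. f x = 0}"
  have M: "subspace ?M"
    using N by (auto simp: subspace_def linear_0[OF f] linear_add[OF f] linear_scale[OF f])
  have gsub: "subspace (g ` Y)" by (rule linear_subspace_image[OF g Y])
  have sum: "{x + y |x y. x \<in> ?M \<and> y \<in> g ` Y} = N"
  proof
    show "{x + y |x y. x \<in> ?M \<and> y \<in> g ` Y} \<subseteq> N"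
      using gY N by (auto intro: subspace_add)
    show "N \<subseteq> {x + y |x y. x \<in> ?M \<and> y \<in> g ` Y}"
    proof
      fix x assume x: "x \<in> N"
      have "x - g (f x) \<in> ?M"
        using x fN gY fg N by (simp add: subspace_diff linear_diff[OF f])
      moreover have "x = (x - g (f x)) + g (f x)" by simp
      ultimately show "x \<in> {x + y |x y. x \<in> ?M \<and> y \<in> g ` Y}" using fN[OF x] by blast
    qed
  qed
  have "?M \<inter> g ` Y \<subseteq> {0}"
    using fg linear_0[OF g] by auto
  then have "dim (?M \<inter> g ` Y) = 0" by simp
  then have "dim N = dim ?M + dim (g ` Y)"
    using dim_sums_Int[OF M gsub] unfolding sum by linarith
  also have "dim (g ` Y) = dim Y"
  proof (rule dim_image_eq[OF g])
    have "inj_on g Y" using fg by (rule inj_on_inverseI)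
    then show "inj_on g (span Y)" unfolding span_eq_iff[THEN iffD2, OF Y] .
  qed
  finally show ?thesis .
qed

text \<open>The matrix \<open>y w\<^sup>T - w y\<^sup>T\<close>, an infinitesimal rotation in the plane of \<open>w\<close> and \<open>y\<close>.\<close>
definition wedge :: "real ^ 'n \<Rightarrow> real ^ 'n \<Rightarrow> real ^ 'n ^ 'n" where
  "wedge w y = (\<chi> i j. y $ i * w $ j - w $ i * y $ j)"

lemma wedge_mult: "wedge w y *v x = (w \<bullet> x) *\<^sub>R y - (y \<bullet> x) *\<^sub>R w"
  by (simp add: wedge_def vec_eq_iff matrix_vector_mult_def inner_vec_def algebra_simps
      sum_subtractf sum_distrib_left)

lemma transpose_wedge: "transpose (wedge w y) = - wedge w y"
  by (simp add: wedge_def transpose_def vec_eq_iff)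

lemma linear_wedge: "linear (wedge w)"
  by (rule linearI) (simp_all add: wedge_def vec_eq_iff algebra_simps)

lemma orthogonal_comp_span: "(span T)\<^sup>\<bottom> = T\<^sup>\<bottom>"
  for T :: "'a::euclidean_space set"
proof
  show "(span T)\<^sup>\<bottom> \<subseteq> T\<^sup>\<bottom>" by (rule orthogonal_comp_anti_mono) (rule span_superset)
  show "T\<^sup>\<bottom> \<subseteq> (span T)\<^sup>\<bottom>"
    using orthogonal_comp_anti_mono[of "span T" "T\<^sup>\<bottom>\<^sup>\<bottom>"] orthogonal_comp_subset[of T]
      orthogonal_comp_self[OF subspace_orthogonal_comp, of T]
      span_minimal[OF _ subspace_orthogonal_comp, of T "T\<^sup>\<bottom>"] by simp
qed

lemma mem_orthogonal_comp: "x \<in> T\<^sup>\<bottom> \<longleftrightarrow> (\<forall>t\<in>T. t \<bullet> x = 0)"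
  by (simp add: orthogonal_comp_def orthogonal_def)

text \<open>Enlarging the space in which a motion acts by a new direction \<open>w\<close> adds the freedom to choose
  the velocity \<open>A w\<close>, which is orthogonal to \<open>w\<close>, and the component of \<open>b\<close> along \<open>w\<close>. The map \<open>f\<close>
  below records both as one arbitrary vector of the span of \<open>insert w T\<close>, and \<open>wedge\<close> yields a
  section of it.\<close>
lemma dim_motions_fixing_orthogonal_comp_insert:
  fixes T :: "(real ^ 'n) set"
  assumes w: "norm w = 1" "w \<in> T\<^sup>\<bottom>"
  shows "dim (motions_fixing ((insert w T)\<^sup>\<bottom>)) = dim (motions_fixing (T\<^sup>\<bottom>)) + dim (insert w T)"
proof -
  let ?N = "motions_fixing ((insert w T)\<^sup>\<bottom>)" and ?M = "motions_fixing (T\<^sup>\<bottom>)"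
  let ?Y = "span (insert w T)"
  have ww: "w \<bullet> w = 1" using w(1) by (simp add: dot_square_norm)
  define f where "f = (\<lambda>(A :: real ^ 'n ^ 'n, b). A *v w + (b \<bullet> w) *\<^sub>R w)"
  define g where "g y = (wedge w y, (y \<bullet> w) *\<^sub>R w)" for y
  have f: "linear f"
    by (intro linearI) (auto simp: f_def algebra_simps matrix_vector_mult_add_rdistrib
        scaleR_matrix_vector_assoc[symmetric])
  have g: "linear g"
    by (intro linearI) (simp_all add: g_def linear_add[OF linear_wedge] linear_scale[OF linear_wedge]
        inner_add_left scaleR_add_left)
  have Yperp: "y \<bullet> x = 0" if "y \<in> ?Y" "x \<in> (insert w T)\<^sup>\<bottom>" for x y
    using that orthogonal_comp_span[of "insert w T"] by (metis mem_orthogonal_comp)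
  have wY: "w \<in> ?Y" by (simp add: span_base)
  have M: "?M = {S \<in> ?N. f S = 0}"
  proof (intro equalityI subsetI)
    fix S assume S: "S \<in> ?M"
    obtain A b where Ab: "S = (A, b)" by (cases S)
    have "(insert w T)\<^sup>\<bottom> \<subseteq> T\<^sup>\<bottom>" by (rule orthogonal_comp_anti_mono) auto
    then have "S \<in> ?N" using S by (auto simp: motions_fixing_def)
    moreover have "A *v w = 0" "w \<bullet> b = 0" using S w(2) by (auto simp: motions_fixing_def Ab)
    ultimately show "S \<in> {S \<in> ?N. f S = 0}" by (simp add: f_def Ab inner_commute)
  next
    fix S assume S: "S \<in> {S \<in> ?N. f S = 0}"
    obtain A b where Ab: "S = (A, b)" by (cases S)
    have skew: "transpose A = - A" using S by (simp add: motions_fixing_def Ab)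
    have eq: "A *v w + (b \<bullet> w) *\<^sub>R w = 0" using S by (simp add: f_def Ab)
    have "w \<bullet> (A *v w + (b \<bullet> w) *\<^sub>R w) = b \<bullet> w"
      by (simp add: inner_add_right skew_inner_self[OF skew] ww)
    then have bw: "b \<bullet> w = 0" using eq by simp
    then have Aw: "A *v w = 0" using eq by simp
    have "A *v x = 0 \<and> x \<bullet> b = 0" if x: "x \<in> T\<^sup>\<bottom>" for x
    proof -
      have "x - (x \<bullet> w) *\<^sub>R w \<in> (insert w T)\<^sup>\<bottom>"
        using x w(2) ww by (auto simp: mem_orthogonal_comp inner_diff_right inner_commute)
      then have "A *v (x - (x \<bullet> w) *\<^sub>R w) = 0" "(x - (x \<bullet> w) *\<^sub>R w) \<bullet> b = 0"
        using S by (auto simp: motions_fixing_def Ab)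
      then show ?thesis
        using Aw bw by (simp add: matrix_vector_mult_diff_distrib matrix_vector_mult_scaleR
            inner_diff_left inner_commute[of w])
    qed
    then show "S \<in> ?M" using skew by (simp add: motions_fixing_def Ab)
  qed
  have "dim ?N = dim {S \<in> ?N. f S = 0} + dim ?Y"
  proof (rule dim_eq_dim_kernel_add[OF f g subspace_motions_fixing subspace_span])
    show "f (g y) = y" for y
      using ww by (simp add: f_def g_def wedge_mult)
    show "g y \<in> ?N" if "y \<in> ?Y" for y
      using Yperp[OF that] Yperp[OF wY]
      by (simp add: g_def motions_fixing_def transpose_wedge wedge_mult inner_commute)
    show "f S \<in> ?Y" if S: "S \<in> ?N" for S
    proof -
      obtain A b where Ab: "S = (A, b)" by (cases S)
      have skew: "transpose A = - A" using S by (simp add: motions_fixing_def Ab)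
      have "x \<bullet> f S = 0" if x: "x \<in> (insert w T)\<^sup>\<bottom>" for x
      proof -
        have "A *v x = 0" using S x by (auto simp: motions_fixing_def Ab)
        then have "x \<bullet> (A *v w) = 0" using skew_inner[OF skew, of x w] by simp
        then show ?thesis using Yperp[OF wY x] by (simp add: f_def Ab inner_add_right inner_commute)
      qed
      then have "f S \<in> (insert w T)\<^sup>\<bottom>\<^sup>\<bottom>" by (simp add: mem_orthogonal_comp)
      then show ?thesis
        using orthogonal_comp_self[of ?Y] by (simp add: orthogonal_comp_span)
    qed
  qed
  then show ?thesis by (simp add: M)
qed

text \<open>The directions of an orthonormal basis of the complement of \<open>U\<close> are added one at a time, so that
  the dimension becomes \<open>1 + 2 + \<dots> + (d - dim U)\<close>.\<close>
lemma dim_motions_fixing: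
  fixes U :: "(real ^ 'n) set"
  shows "dim (motions_fixing U) = (CARD('n) - dim U + 1) choose 2"
proof -
  let ?W = "(span U)\<^sup>\<bottom>"
  obtain B where B: "B \<subseteq> ?W" "pairwise orthogonal B" "\<And>x. x \<in> B \<Longrightarrow> norm x = 1"
      "independent B" "card B = dim ?W" "span B = ?W"
    using orthonormal_basis_subspace[OF subspace_orthogonal_comp[of "span U"]] by blast
  have finB: "finite B" using B(4) by (rule independent_imp_finite)
  have "dim (motions_fixing (T\<^sup>\<bottom>)) = (card T + 1) choose 2" if "T \<subseteq> B" for T
  proof -
    have "finite T" using that finB finite_subset by blast
    then show ?thesis using that
    proof (induction T rule: finite_induct)
      case empty
      have "motions_fixing ({}\<^sup>\<bottom> :: (real ^ 'n) set) \<subseteq> {0}"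
      proof
        fix S :: "(real ^ 'n ^ 'n) \<times> (real ^ 'n)"
        assume S: "S \<in> motions_fixing ({}\<^sup>\<bottom>)"
        obtain A b where Ab: "S = (A, b)" by (cases S)
        have "\<And>u. A *v u = 0 \<and> u \<bullet> b = 0"
          using S by (auto simp: motions_fixing_def Ab mem_orthogonal_comp)
        then have "A = 0" "b = 0"
          by (auto simp: matrix_eq) (metis inner_eq_zero_iff)
        then show "S \<in> {0}" by (simp add: Ab zero_prod_def)
      qed
      then have "dim (motions_fixing ({}\<^sup>\<bottom> :: (real ^ 'n) set)) = 0" by simp
      moreover have "(card ({} :: (real ^ 'n) set) + 1) choose 2 = 0" by (simp add: binomial_eq_0)
      ultimately show ?case by (rule trans[OF _ sym])
    next
      case (insert w T)
      have "w \<in> T\<^sup>\<bottom>"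
        using insert.prems insert.hyps B(2)
        by (auto simp: mem_orthogonal_comp pairwise_def orthogonal_def)
      then have "dim (motions_fixing ((insert w T)\<^sup>\<bottom>)) = dim (motions_fixing (T\<^sup>\<bottom>)) + dim (insert w T)"
        using B(3) insert.prems by (intro dim_motions_fixing_orthogonal_comp_insert) auto
      moreover have "dim (insert w T) = card (insert w T)"
        using independent_mono[OF B(4) insert.prems] by (rule dim_eq_card_independent)
      ultimately show ?case using insert by (simp add: choose_two numeral_2_eq_2)
    qed
  qed
  from this[of B] have "dim (motions_fixing (B\<^sup>\<bottom>)) = (dim ?W + 1) choose 2"
    using B(5) by simp
  moreover have "B\<^sup>\<bottom> = span U"
    using orthogonal_comp_span[of B] B(6) orthogonal_comp_self[of "span U"] by simp
  moreover have "dim ?W + dim U = CARD('n)"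
    using dim_subspace_orthogonal_to_vectors[OF subspace_span subspace_UNIV, of U]
    by (simp add: orthogonal_comp_def)
  ultimately show ?thesis
    by (simp add: motions_fixing_span flip: \<open>dim ?W + dim U = CARD('n)\<close>)
qed

text \<open>The \<open>i\<close>-th of \<open>k\<close> independent loop directions takes away \<open>d - i + 1\<close> degrees of freedom.\<close>
lemma sum_codimensions:
  fixes k d :: nat
  assumes "k \<le> d"
  shows "(\<Sum>i = 1..int k. int d - i + 1) = int ((d + 1) choose 2) - int ((d - k + 1) choose 2)"
  using assms
proof (induction k)
  case (Suc k)
  have "{1..int (Suc k)} = insert (int (Suc k)) {1..int k}" by auto
  then have "(\<Sum>i = 1..int (Suc k). int d - i + 1) = (int d - int k) + (\<Sum>i = 1..int k. int d - i + 1)"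
    by simp
  moreover have "d - k + 1 = Suc (d - Suc k + 1)" using Suc.prems by simp
  then have "((d - k + 1) choose 2) = ((d - Suc k + 1) choose 2) + (d - k)"
    by (simp add: numeral_2_eq_2)
  ultimately show ?case using Suc by (simp add: of_nat_diff)
qed simp

lemma sum_codimensions_proj_dim:
  fixes S :: "(real ^ 'n) set"
  shows "(\<Sum>i = 1..proj_dim S + 1. int CARD('n) - i + 1) =
    int ((CARD('n) + 1) choose 2) - int (dim (motions_fixing S))"
  using sum_codimensions[of "dim S" "CARD('n)"] dim_subset_UNIV_cart[of S]
  by (simp add: proj_dim_def dim_motions_fixing)

text \<open>The restriction of the sum to parts with loops is harmless: a part without loops has
  \<open>proj_dim {} = -1\<close>, hence an empty inner sum, and all \<open>(d + 1) choose 2\<close> degrees of freedom.\<close>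
lemma count_eq_sum_dim_motions_fixing:
  fixes q :: "'l \<Rightarrow> real ^ 'n" and G :: "('v, 'e, 'l) loop_graph"
  assumes "finite P"
  shows "int ((CARD('n) + 1) choose 2) * int (card P)
      - (\<Sum>X\<in>{X \<in> P. loops_at G X \<noteq> {}}.
           \<Sum>i = 1..proj_dim (q ` loops_at G X) + 1. int CARD('n) - i + 1)
    = int (\<Sum>X\<in>P. dim (motions_fixing (q ` loops_at G X)))"
proof -
  let ?s = "\<lambda>X. \<Sum>i = 1..proj_dim (q ` loops_at G X) + 1. int CARD('n) - i + 1"
  have "(\<Sum>X\<in>{X \<in> P. loops_at G X \<noteq> {}}. ?s X) = (\<Sum>X\<in>P. ?s X)"
    by (rule sum.mono_neutral_left[OF assms]) (auto simp: proj_dim_def)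
  also have "\<dots> = int ((CARD('n) + 1) choose 2) * int (card P)
      - (\<Sum>X\<in>P. int (dim (motions_fixing (q ` loops_at G X))))"
    by (simp add: sum_codimensions_proj_dim sum_subtractf)
  finally show ?thesis by simp
qed

section \<open>Bars, loops and bodies\<close>

text \<open>The component along \<open>r\<close> of the velocity that the motion gives to \<open>a\<close>. In projective terms, these
  are the functionals given by the Pluecker coordinates of lines.\<close>
definition bar :: "real ^ 'n \<Rightarrow> real ^ 'n \<Rightarrow> (real ^ 'n ^ 'n) \<times> (real ^ 'n) \<Rightarrow> real" where
  "bar a r S = r \<bullet> (fst S *v a + snd S)"

lemma linear_bar: "linear (bar a r)"
  by (rule linearI) (simp_all add: bar_def matrix_vector_mult_add_rdistrib inner_add_right
      scaleR_matrix_vector_assoc[symmetric] algebra_simps)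

text \<open>Both bodies may be evaluated at the same end-point of the bar, because a rigid motion gives all
  points of a line the same velocity along it. Thus a bar equates one functional on two motions.\<close>
lemma bar_constraint:
  fixes A A' :: "real ^ 'n ^ 'n"
  assumes "transpose A' = - A'"
  shows "(a - c) \<bullet> ((A *v a + b) - (A' *v c + b')) = bar a (a - c) (A, b) - bar a (a - c) (A', b')"
proof -
  have "(a - c) \<bullet> (A' *v a) - (a - c) \<bullet> (A' *v c) = 0"
    using skew_inner_self[OF assms, of "a - c"]
    by (simp add: matrix_vector_mult_diff_distrib inner_diff_right)
  then show ?thesis by (simp add: bar_def inner_diff_right inner_add_right)
qed

text \<open>Bars through the origin see \<open>b\<close>, and bars through the unit vectors then see the columns of \<open>A\<close>.
  So finitely many lines suffice.\<close>
lemma bars_separate_motions: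
  fixes S S' :: "(real ^ 'n ^ 'n) \<times> (real ^ 'n)"
  assumes "\<And>a r. a \<in> insert 0 Basis \<Longrightarrow> r \<in> Basis \<Longrightarrow> bar a r S = bar a r S'"
  shows "S = S'"
proof -
  have eq: "fst S *v a + snd S = fst S' *v a + snd S'" if "a \<in> insert 0 Basis" for a
  proof (rule euclidean_eqI)
    fix r :: "real ^ 'n" assume "r \<in> Basis"
    from assms[OF that this] show "(fst S *v a + snd S) \<bullet> r = (fst S' *v a + snd S') \<bullet> r"
      unfolding bar_def by (subst (1 2) inner_commute)
  qed
  have b: "snd S = snd S'" using eq[of 0] by simp
  then have "fst S *v axis j 1 = fst S' *v axis j 1" for j :: 'n
    using eq[of "axis j 1"] b by (simp add: axis_in_Basis_iff)
  then have "fst S = fst S'"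
    by (simp add: matrix_vector_mult_basis column_def vec_eq_iff)
  with b show ?thesis by (simp add: prod_eq_iff)
qed

lemma loop_constraint_everywhere_iff:
  fixes A :: "real ^ 'n ^ 'n"
  assumes "transpose A = - A"
  shows "(\<forall>x. q \<bullet> (A *v x + b) = 0) \<longleftrightarrow> A *v q = 0 \<and> q \<bullet> b = 0"
proof
  assume *: "\<forall>x. q \<bullet> (A *v x + b) = 0"
  then have b: "q \<bullet> b = 0" by (metis add.left_neutral matrix_vector_mult_0_right)
  have "q \<bullet> (A *v (A *v q)) = 0" using * b by (simp add: inner_add_right)
  then show "A *v q = 0 \<and> q \<bullet> b = 0" using b skew_inner[OF assms, of q "A *v q"] by simp
qed (simp add: inner_add_right skew_inner[OF assms])

text \<open>The zeros of an affine map form an affine subspace, hence it vanishes everywhere if it does so on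
  an affinely spanning body.\<close>
lemma motion_zero_on_full_body:
  fixes A :: "real ^ 'n ^ 'n"
  assumes B: "aff_dim B = int CARD('n)" and zero: "\<And>x. x \<in> B \<Longrightarrow> A *v x + b = 0"
  shows "A = 0 \<and> b = 0"
proof -
  have aff: "affine {x. A *v x + b = 0}"
    unfolding affine_def
  proof (intro allI ballI impI)
    fix x y and u v :: real
    assume "x \<in> {x. A *v x + b = 0}" "y \<in> {x. A *v x + b = 0}" and uv: "u + v = 1"
    then have "u *\<^sub>R (A *v x + b) + v *\<^sub>R (A *v y + b) = 0" by simp
    then have "A *v (u *\<^sub>R x + v *\<^sub>R y) + (u + v) *\<^sub>R b = 0"
      by (simp add: matrix_vector_right_distrib matrix_vector_mult_scaleR algebra_simps)
    then show "u *\<^sub>R x + v *\<^sub>R y \<in> {x. A *v x + b = 0}" using uv by simp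
  qed
  have "affine hull B = UNIV" using B aff_dim_eq_full[of B] by simp
  moreover have "affine hull B \<subseteq> {x. A *v x + b = 0}"
    using zero aff by (intro hull_minimal) auto
  ultimately have all: "A *v x + b = 0" for x by blast
  have b: "b = 0" using all[of 0] by simp
  then show ?thesis using all by (simp add: matrix_eq)
qed

section \<open>Rigid frameworks\<close>

lemma ex_edge_ends:
  assumes "wf_loop_graph G"
  obtains s t where "\<And>e. e \<in> edges G \<Longrightarrow> ends G e = {s e, t e} \<and> s e \<noteq> t e \<and> s e \<in> verts G \<and> t e \<in> verts G"
proof -
  have "\<forall>e\<in>edges G. \<exists>p. ends G e = {fst p, snd p} \<and> fst p \<noteq> snd p \<and> fst p \<in> verts G \<and> snd p \<in> verts G"
  proof
    fix e assume "e \<in> edges G"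
    then have "card (ends G e) = 2" "ends G e \<subseteq> verts G" using assms by (auto simp: wf_loop_graph_def)
    then obtain x y where "ends G e = {x, y}" "x \<noteq> y" "x \<in> verts G" "y \<in> verts G"
      by (auto simp: card_2_iff)
    then show "\<exists>p. ends G e = {fst p, snd p} \<and> fst p \<noteq> snd p \<and> fst p \<in> verts G \<and> snd p \<in> verts G"
      by (intro exI[of _ "(x, y)"]) simp
  qed
  then obtain p where "\<forall>e\<in>edges G. ends G e = {fst (p e), snd (p e)} \<and> fst (p e) \<noteq> snd (p e)
      \<and> fst (p e) \<in> verts G \<and> snd (p e) \<in> verts G" by (rule bchoice[THEN exE])
  then show thesis using that[of "fst \<circ> p" "snd \<circ> p"] by simp
qed

lemma cross_count_eq:
  assumes P: "partition_on V P"
    and st: "\<And>e. e \<in> edges G \<Longrightarrow> ends G e = {s e, t e} \<and> s e \<in> V \<and> t e \<in> V"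
  shows "cross_count G P = card {e \<in> edges G. \<not> (\<exists>X\<in>P. s e \<in> X \<and> t e \<in> X)}"
proof -
  have disj: "X = Y" if "X \<in> P" "Y \<in> P" "v \<in> X" "v \<in> Y" for X Y v
    using that P by (auto simp: partition_on_def disjoint_def)
  have "(\<exists>X\<in>P. \<exists>Y\<in>P. X \<noteq> Y \<and> ends G e \<inter> X \<noteq> {} \<and> ends G e \<inter> Y \<noteq> {}) \<longleftrightarrow>
      \<not> (\<exists>X\<in>P. s e \<in> X \<and> t e \<in> X)" if e: "e \<in> edges G" for e
  proof -
    obtain X Y where XY: "X \<in> P" "s e \<in> X" "Y \<in> P" "t e \<in> Y"
      using st[OF e] P by (auto simp: partition_on_def)
    have meet: "Z = X \<or> Z = Y" if "Z \<in> P" "ends G e \<inter> Z \<noteq> {}" for Z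
      using that st[OF e] XY disj by auto
    have "(\<exists>X\<in>P. s e \<in> X \<and> t e \<in> X) \<longleftrightarrow> X = Y" using XY disj by blast
    moreover have "ends G e \<inter> X \<noteq> {}" "ends G e \<inter> Y \<noteq> {}" using st[OF e] XY by auto
    ultimately show ?thesis using meet XY by blast
  qed
  then show ?thesis unfolding cross_count_def by (intro arg_cong[of _ _ card] Collect_cong conj_cong refl)
qed

lemma infinitesimal_motion_iff:
  fixes G :: "('v, 'e, 'l) loop_graph" and q :: "'l \<Rightarrow> real ^ 'n"
  assumes st: "\<And>e. e \<in> edges G \<Longrightarrow> ends G e = {s e, t e}"
    and skew: "\<And>v. v \<in> verts G \<Longrightarrow> transpose (A v) = - A v"
    and V: "\<And>e. e \<in> edges G \<Longrightarrow> t e \<in> verts G"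
  shows "infinitesimal_motion G q B p A b \<longleftrightarrow>
     (\<forall>e\<in>edges G. bar (p e (s e)) (p e (s e) - p e (t e)) (A (s e), b (s e))
        = bar (p e (s e)) (p e (s e) - p e (t e)) (A (t e), b (t e))) \<and>
     (\<forall>l\<in>loops G. \<forall>x\<in>B (base G l). q l \<bullet> (A (base G l) *v x + b (base G l)) = 0)"
proof -
  let ?bar = "\<lambda>e u v. (p e u - p e v) \<bullet> ((A u *v p e u + b u) - (A v *v p e v + b v))"
  have "?bar e u v = ?bar e v u" for e u v
    by (simp add: inner_diff_left inner_diff_right)
  then have "(\<forall>u v. ends G e = {u, v} \<longrightarrow> ?bar e u v = 0) \<longleftrightarrow> ?bar e (s e) (t e) = 0"
    if "e \<in> edges G" for e
    using st[OF that] by (auto simp: doubleton_eq_iff)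
  then show ?thesis
    unfolding infinitesimal_motion_def using skew bar_constraint[OF skew[OF V]] by simp
qed

text \<open>Necessity: the motions that move each part of \<open>P\<close> as a single body and respect the loops are
  only restricted by the crossing bars.\<close>
lemma sum_dim_le_cross_count_if_rigid:
  fixes G :: "('v, 'e, 'l) loop_graph" and q :: "'l \<Rightarrow> real ^ 'n"
  assumes G: "wf_loop_graph G" and real: "realisation G B p"
    and rigid: "infinitesimally_rigid G q B p" and P: "partition_on (verts G) P"
  shows "(\<Sum>X\<in>P. dim (motions_fixing (q ` loops_at G X))) \<le> cross_count G P"
proof -
  obtain s t where st: "\<And>e. e \<in> edges G \<Longrightarrow>
      ends G e = {s e, t e} \<and> s e \<noteq> t e \<and> s e \<in> verts G \<and> t e \<in> verts G"
    using ex_edge_ends[OF G] by blast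
  have finP: "finite P" using finite_elements[OF _ P] G by (simp add: wf_loop_graph_def)
  define F where "F = {e \<in> edges G. \<not> (\<exists>X\<in>P. s e \<in> X \<and> t e \<in> X)}"
  have F: "finite F" "cross_count G P = card F"
    using G cross_count_eq[OF P, of G s t] st by (auto simp: F_def wf_loop_graph_def)
  define c where "c v = (THE X. X \<in> P \<and> v \<in> X)" for v
  have c_eq: "c v = X" if "X \<in> P" "v \<in> X" for v X
    unfolding c_def using that P by (intro the_equality) (auto simp: partition_on_def disjoint_def)
  have c_in: "c v \<in> P" "v \<in> c v" if "v \<in> verts G" for v
  proof -
    have "v \<in> \<Union>P" using that P by (simp add: partition_on_def)
    then obtain X where "X \<in> P" "v \<in> X" by blast
    then show "c v \<in> P" "v \<in> c v" using c_eq by auto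
  qed
  define Z where "Z = product_space P (\<lambda>X. motions_fixing (q ` loops_at G X))"
  define \<phi> where "\<phi> e z = bar (p e (s e)) (p e (s e) - p e (t e)) (z (c (s e)))
      - bar (p e (s e)) (p e (s e) - p e (t e)) (z (c (t e)))"
    for e and z :: "'v set \<Rightarrow> (real ^ 'n ^ 'n) \<times> (real ^ 'n)"
  have "dim Z \<le> card F"
  proof (rule dim_le_card_functionals)
    show "subspace Z"
      unfolding Z_def by (rule subspace_product_space) (rule subspace_motions_fixing)
    show "finite F" by (rule F)
    show "linear (\<phi> e)" for e
      by (intro linearI)
        (simp_all add: \<phi>_def linear_add[OF linear_bar] linear_scale[OF linear_bar] algebra_simps)
    fix z assume z: "z \<in> Z" and zero: "\<And>e. e \<in> F \<Longrightarrow> \<phi> e z = 0"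
    define A where "A v = fst (z (c v))" for v
    define b where "b v = snd (z (c v))" for v
    have zfix: "z (c v) \<in> motions_fixing (q ` loops_at G (c v))" if "v \<in> verts G" for v
      using z c_in(1)[OF that] by (simp add: Z_def product_space_def)
    have skew: "transpose (A v) = - A v" if "v \<in> verts G" for v
      using zfix[OF that] by (simp add: motions_fixing_def A_def case_prod_unfold)
    have "infinitesimal_motion G q B p A b"
    proof (subst infinitesimal_motion_iff[of _ s t])
      show "(\<forall>e\<in>edges G. bar (p e (s e)) (p e (s e) - p e (t e)) (A (s e), b (s e))
          = bar (p e (s e)) (p e (s e) - p e (t e)) (A (t e), b (t e))) \<and>
        (\<forall>l\<in>loops G. \<forall>x\<in>B (base G l). q l \<bullet> (A (base G l) *v x + b (base G l)) = 0)"
      proof (intro conjI ballI)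
        fix e assume e: "e \<in> edges G"
        have "\<phi> e z = 0"
        proof (cases "e \<in> F")
          case False
          then obtain X where "X \<in> P" "s e \<in> X" "t e \<in> X" using e by (auto simp: F_def)
          then have "c (s e) = c (t e)" using c_eq by metis
          then show ?thesis by (simp add: \<phi>_def)
        qed (rule zero)
        then show "bar (p e (s e)) (p e (s e) - p e (t e)) (A (s e), b (s e))
          = bar (p e (s e)) (p e (s e) - p e (t e)) (A (t e), b (t e))"
          by (simp add: \<phi>_def A_def b_def)
      next
        fix l x assume l: "l \<in> loops G"
        then have v: "base G l \<in> verts G" using G by (simp add: wf_loop_graph_def)
        have "l \<in> loops_at G (c (base G l))" using l c_in(2)[OF v] by (simp add: loops_at_def)
        then have "A (base G l) *v q l = 0 \<and> q l \<bullet> b (base G l) = 0"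
          using zfix[OF v] by (auto simp: motions_fixing_def A_def b_def split: prod.splits)
        then show "q l \<bullet> (A (base G l) *v x + b (base G l)) = 0"
          using loop_constraint_everywhere_iff[OF skew[OF v]] by blast
      qed
    qed (use st skew in auto)
    then have motion_zero: "A v *v x + b v = 0" if "v \<in> verts G" "x \<in> B v" for v x
      using rigid that unfolding infinitesimally_rigid_def by blast
    show "z = 0"
    proof
      fix X
      show "z X = 0 X"
      proof (cases "X \<in> P")
        case True
        then have "X \<noteq> {}" using P by (auto simp: partition_on_def)
        then obtain v where v: "v \<in> X" by blast
        then have vG: "v \<in> verts G" using True P by (auto simp: partition_on_def)
        have "aff_dim (B v) = int CARD('n)" using real vG by (simp add: realisation_def)
        then have "A v = 0 \<and> b v = 0"
          by (rule motion_zero_on_full_body) (rule motion_zero[OF vG])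
        then show ?thesis using c_eq[OF True v] by (simp add: A_def b_def prod_eq_iff)
      next
        case False
        then show ?thesis using z by (simp add: Z_def product_space_def)
      qed
    qed
  qed
  then show ?thesis
    unfolding Z_def F(2) by (simp add: dim_product_space[OF finP] subspace_motions_fixing)
qed

text \<open>Sufficiency: every body is the whole space, so that any line can carry any bar.\<close>
lemma rigid_realisation_exists:
  fixes G :: "('v, 'e, 'l) loop_graph" and q :: "'l \<Rightarrow> real ^ 'n"
  assumes G: "wf_loop_graph G"
    and count: "\<And>P. partition_on (verts G) P \<Longrightarrow>
      (\<Sum>X\<in>P. dim (motions_fixing (q ` loops_at G X))) \<le> cross_count G P"
  shows "\<exists>B p. realisation G B p \<and> infinitesimally_rigid G q B p"
proof -
  obtain s t where st: "\<And>e. e \<in> edges G \<Longrightarrow>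
      ends G e = {s e, t e} \<and> s e \<noteq> t e \<and> s e \<in> verts G \<and> t e \<in> verts G"
    using ex_edge_ends[OF G] by blast
  define C where "C v = motions_fixing (q ` loops_at G {v})" for v
  define K where "K = (\<lambda>(a, r). bar a r) ` (insert 0 Basis \<times> (Basis :: (real ^ 'n) set))"
  have "\<exists>k. (\<forall>e\<in>edges G. k e \<in> K) \<and>
    (\<forall>S. (\<forall>v\<in>verts G. S v \<in> C v) \<and> (\<forall>e\<in>edges G. k e (S (s e)) = k e (S (t e))) \<longrightarrow>
      (\<forall>v\<in>verts G. S v = 0))"
  proof (rule separating_family_on_edges)
    show "finite (verts G)" "finite (edges G)" using G by (auto simp: wf_loop_graph_def)
    show "s e \<in> verts G" "t e \<in> verts G" if "e \<in> edges G" for e using st[OF that] by auto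
    show "subspace (C v)" for v unfolding C_def by (rule subspace_motions_fixing)
    show "finite K" "K \<noteq> {}" by (auto simp: K_def)
    show "linear \<phi>" if "\<phi> \<in> K" for \<phi> using that linear_bar by (auto simp: K_def)
    show "x = y" if "\<And>\<phi>. \<phi> \<in> K \<Longrightarrow> \<phi> x = \<phi> y" for x y
      by (rule bars_separate_motions, rule that) (auto simp: K_def)
    show "(\<Sum>X\<in>P. dim (\<Inter>v\<in>X. C v)) \<le> card {e \<in> edges G. \<not> (\<exists>X\<in>P. s e \<in> X \<and> t e \<in> X)}"
      if P: "partition_on (verts G) P" for P
    proof -
      have "(\<Inter>v\<in>X. C v) = motions_fixing (q ` loops_at G X)" if "X \<in> P" for X
      proof -
        have "X \<noteq> {}" using that P by (auto simp: partition_on_def)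
        moreover have "(\<Union>v\<in>X. q ` loops_at G {v}) = q ` loops_at G X" by (auto simp: loops_at_def)
        ultimately show ?thesis unfolding C_def by (simp add: motions_fixing_Union)
      qed
      then show ?thesis using count[OF P] cross_count_eq[OF P, of G s t] st by simp
    qed
  qed
  then obtain k where kK: "\<forall>e\<in>edges G. k e \<in> K"
    and k: "\<And>S. (\<forall>v\<in>verts G. S v \<in> C v) \<and> (\<forall>e\<in>edges G. k e (S (s e)) = k e (S (t e))) \<Longrightarrow>
      \<forall>v\<in>verts G. S v = 0" by blast
  have "\<forall>e\<in>edges G. \<exists>ar. k e = bar (fst ar) (snd ar)"
    using kK unfolding K_def by fastforce
  then obtain ar where ar: "\<forall>e\<in>edges G. k e = bar (fst (ar e)) (snd (ar e))"
    by (rule bchoice[THEN exE])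
  define B :: "'v \<Rightarrow> (real ^ 'n) set" where "B v = UNIV" for v
  \<comment> \<open>The bar runs from \<open>a\<close> to \<open>a - r\<close>, so its direction is the \<open>r\<close> of its functional \<open>bar a r\<close>.\<close>
  define p where "p e v = (if v = s e then fst (ar e) else fst (ar e) - snd (ar e))" for e v
  have "realisation G B p" by (simp add: realisation_def B_def)
  moreover have "infinitesimally_rigid G q B p"
    unfolding infinitesimally_rigid_def
  proof (intro allI impI)
    fix A b assume m: "infinitesimal_motion G q B p A b"
    then have skew: "transpose (A v) = - A v" if "v \<in> verts G" for v
      using that by (simp add: infinitesimal_motion_def)
    have m': "(\<forall>e\<in>edges G. bar (p e (s e)) (p e (s e) - p e (t e)) (A (s e), b (s e))
        = bar (p e (s e)) (p e (s e) - p e (t e)) (A (t e), b (t e))) \<and>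
      (\<forall>l\<in>loops G. \<forall>x\<in>B (base G l). q l \<bullet> (A (base G l) *v x + b (base G l)) = 0)"
      by (rule iffD1[OF infinitesimal_motion_iff m]) (use st skew in auto)
    have "\<forall>v\<in>verts G. (A v, b v) = 0"
    proof (rule k, intro conjI ballI)
      fix v assume v: "v \<in> verts G"
      have "A v *v q l = 0 \<and> q l \<bullet> b v = 0" if "l \<in> loops_at G {v}" for l
        using that m' loop_constraint_everywhere_iff[OF skew[OF v], of "q l" "b v"]
        by (auto simp: loops_at_def B_def)
      then show "(A v, b v) \<in> C v" using skew[OF v] by (simp add: C_def motions_fixing_def)
    next
      fix e assume e: "e \<in> edges G"
      have "p e (s e) = fst (ar e)" "p e (s e) - p e (t e) = snd (ar e)"
        using st[OF e] by (auto simp: p_def)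
      then show "k e (A (s e), b (s e)) = k e (A (t e), b (t e))"
        using m' e ar by metis
    qed
    then show "\<forall>v\<in>verts G. \<forall>x\<in>B v. A v *v x + b v = 0" by (simp add: zero_prod_def)
  qed
  ultimately show ?thesis by blast
qed

theorem theorem5p2:
  fixes G :: "('v, 'e, 'l) loop_graph" and q :: "'l \<Rightarrow> real ^ 'n"
  assumes "wf_loop_graph G"
    and "\<forall>l\<in>loops G. q l \<noteq> 0"
  shows "(\<exists>B p. realisation G B p \<and> infinitesimally_rigid G q B p) \<longleftrightarrow>
    (\<forall>P. partition_on (verts G) P \<longrightarrow>
       int (cross_count G P) \<ge>
         int ((CARD('n) + 1) choose 2) * int (card P)
         - (\<Sum>X\<in>{X \<in> P. loops_at G X \<noteq> {}}.
              \<Sum>i = 1..proj_dim (q ` loops_at G X) + 1. int CARD('n) - i + 1))"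
proof -
  have "finite P" if "partition_on (verts G) P" for P
    using finite_elements[OF _ that] assms(1) by (simp add: wf_loop_graph_def)
  then have "(\<forall>P. partition_on (verts G) P \<longrightarrow>
       int (cross_count G P) \<ge>
         int ((CARD('n) + 1) choose 2) * int (card P)
         - (\<Sum>X\<in>{X \<in> P. loops_at G X \<noteq> {}}.
              \<Sum>i = 1..proj_dim (q ` loops_at G X) + 1. int CARD('n) - i + 1)) \<longleftrightarrow>
    (\<forall>P. partition_on (verts G) P \<longrightarrow>
       (\<Sum>X\<in>P. dim (motions_fixing (q ` loops_at G X))) \<le> cross_count G P)"
    by (simp only: count_eq_sum_dim_motions_fixing of_nat_le_iff cong: imp_cong)
  then show ?thesis
    using sum_dim_le_cross_count_if_rigid[OF assms(1)] rigid_realisation_exists[OF assms(1)] by blast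
qed

end
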